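(* Let $p=(\tau,R)$ be a mesh pattern with force $F$, and let $S=\{s_1,s_2,\dots,s_k\}$ be a set of squares of the mesh with $S\cap R=\emptyset$. Suppose that for each $i\in\{1,\dots,k\}$ some mesh pattern in the set $$(\tau,R\cup\{s_1,\dots,s_{i-1}\})^{s_i\star}$$ contains an occurrence of $p$ that is stronger, with respect to $F$, than the trivial occurrence of $p$. Then $p$ and $q=(\tau,R\cup S)$ are coincident, i.e. a permutation avoids $p$ if and only if it avoids $q$.
   Context: Permutations, mesh patterns. A permutation $\pi\in S_n$ is a bijection of $\{1,\dots,n\}$, written as the word $\pi(1)\cdots\pi(n)$; its points are $(x,\pi(x))$. A mesh pattern is a pair $p=(\tau,R)$ with $\tau\in S_k$ and $R\subseteq\{0,\dots,k\}^2$; $(a,b)\in R$ stands for the shaded unit square $[a,a+1]\times[b,b+1]$. Occurrences. Let $\sigma\in S_n$, $\tau\in S_k$. Let $c=\sigma(u_1)\cdots\sigma(u_k)$, $u_1<\dots<u_k$, be a subsequence order isomorphic to $\tau$, with sorted values $v_1<\dots<v_k$, and $u_0=v_0=0$, $u_{k+1}=v_{k+1}=n+1$. It is an occurrence of $(\tau,R)$ in the permutation $\sigma$ if for each $(a,b)\in R$ there is no point of $\sigma$ in $(u_a,u_{a+1})\times(v_b,v_{b+1})$; it is an occurrence of $(\tau,R)$ in the mesh pattern $(\sigma,Y)$ if in addition, for each $(a,b)\in R$, all $(x,y)$ with $u_a\le x<u_{a+1}$, $v_b\le y<v_{b+1}$ belong to $Y$. "Contains" means having an occurrence, "avoids" means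 not containing. Adding a point. For $p=(\tau,R)$, $\tau\in S_n$, and $(i,j)\in\{0,\dots,n\}^2\setminus R$, let $\tau'\in S_{n+1}$ be obtained by inserting a new point at position $i+1$ with value $j+1$ (points of $\tau$ at positions $>i$ move one to the right, values $>j$ increase by one), and let $T'$ be the set of $(a,b)\in\{0,\dots,n+1\}^2$ with $(\phi_i(a),\phi_j(b))\in R$, where $\phi_i(a)=a$ if $a\le i$ and $\phi_i(a)=a-1$ if $a>i$. Put $p^{(i,j)\uparrow}=(\tau',T'\cup\{(i,j+1),(i+1,j+1)\})$, $p^{(i,j)\downarrow}=(\tau',T'\cup\{(i,j),(i+1,j)\})$, $p^{(i,j)\leftarrow}=(\tau',T'\cup\{(i,j),(i,j+1)\})$, $p^{(i,j)\rightarrow}=(\tau',T'\cup\{(i+1,j),(i+1,j+1)\})$, and let $p^{(i,j)\star}$ be the set of these four mesh patterns. The trivial occurrence of $p=(\tau,R)$ in a mesh pattern of $(\tau,R\cup\{s_1,\dots,s_{i-1}\})^{s_i\star}$ is the one consisting of all points other than the inserted one. Forces. A force on a mesh pattern with underlying $\tau\in S_n$ is a tuple $F=((\tau(i_1),a_1),\dots,(\tau(i_\ell),a_\ell))$ with $0\le\ell\le n$, distinct $i_j\in\{1,\dots,n\}$ and $a_j\in\{\uparrow,\downarrow,\leftarrow,\rightarrow\}$. If $c=c_1\cdots c_n$ is an occurrence in a permutation $\sigma$, or in a mesh pattern with underlying permutation $\sigma$, its strength with respect to $F$ is the $\ell$-tuple whose $j$-th entry is $c_{i_j}$, $-c_{i_j}$,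 $-\sigma^{-1}(c_{i_j})$, $\sigma^{-1}(c_{i_j})$ when $a_j$ is $\uparrow,\downarrow,\leftarrow,\rightarrow$ respectively. An occurrence is stronger than another if its strength is strictly larger in lexicographic order. *)

theory Defs
  imports Main "HOL-Combinatorics.Permutations"
begin

text \<open>
  An element of \<open>S\<^sub>n\<close> is a function \<open>\<pi> :: nat \<Rightarrow> nat\<close> with \<open>\<pi> permutes {1..n}\<close>. The length \<open>n\<close> is
  carried along explicitly, since \<open>\<pi>\<close> does not determine it. A mesh pattern \<open>(\<tau>, R)\<close> with
  \<open>\<tau> \<in> S\<^sub>k\<close> is the triple \<open>(k, \<tau>, R)\<close>.
\<close>

type_synonym square = "nat \<times> nat"
type_synonym mesh = "nat \<times> (nat \<Rightarrow> nat) \<times> square set"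

fun mesh_pattern :: "mesh \<Rightarrow> bool" where
  "mesh_pattern (k, \<tau>, R) \<longleftrightarrow> \<tau> permutes {1..k} \<and> R \<subseteq> {0..k} \<times> {0..k}"

fun underlying :: "mesh \<Rightarrow> nat \<Rightarrow> nat" where
  "underlying (k, \<tau>, R) = \<tau>"

text \<open>
  A subsequence \<open>\<sigma>(u\<^sub>1) \<dots> \<sigma>(u\<^sub>k)\<close> of \<open>\<sigma> \<in> S\<^sub>n\<close> is given by its positions \<open>u\<close>, together with the
  conventions \<open>u 0 = 0\<close> and \<open>u (k + 1) = n + 1\<close>; values of \<open>u\<close> beyond \<open>k + 1\<close> are irrelevant.
  The function \<open>v\<close> lists the sorted values, with the same conventions at \<open>0\<close> and \<open>k + 1\<close>; it is
  determined by \<open>u\<close> on \<open>{0..k + 1}\<close>.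
\<close>

definition embeds :: "nat \<Rightarrow> (nat \<Rightarrow> nat) \<Rightarrow> nat \<Rightarrow> (nat \<Rightarrow> nat) \<Rightarrow> (nat \<Rightarrow> nat) \<Rightarrow> (nat \<Rightarrow> nat) \<Rightarrow> bool" where
  "embeds k \<tau> n \<sigma> u v \<longleftrightarrow>
     u 0 = 0 \<and> u (k + 1) = n + 1 \<and> strict_mono_on {0..k + 1} u \<and>
     v 0 = 0 \<and> v (k + 1) = n + 1 \<and> strict_mono_on {0..k + 1} v \<and>
     v ` {1..k} = (\<lambda>i. \<sigma> (u i)) ` {1..k} \<and>
     (\<forall>i\<in>{1..k}. \<forall>j\<in>{1..k}. \<sigma> (u i) < \<sigma> (u j) \<longleftrightarrow> \<tau> i < \<tau> j)"

definition shading_empty ::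
  "square set \<Rightarrow> nat \<Rightarrow> (nat \<Rightarrow> nat) \<Rightarrow> (nat \<Rightarrow> nat) \<Rightarrow> (nat \<Rightarrow> nat) \<Rightarrow> bool" where
  "shading_empty R n \<sigma> u v \<longleftrightarrow>
     (\<forall>(a, b)\<in>R. \<not> (\<exists>x\<in>{1..n}. u a < x \<and> x < u (a + 1) \<and> v b < \<sigma> x \<and> \<sigma> x < v (b + 1)))"

fun occurrence_in_perm :: "mesh \<Rightarrow> nat \<Rightarrow> (nat \<Rightarrow> nat) \<Rightarrow> (nat \<Rightarrow> nat) \<Rightarrow> bool" where
  "occurrence_in_perm (k, \<tau>, R) n \<sigma> u \<longleftrightarrow>
     (\<exists>v. embeds k \<tau> n \<sigma> u v \<and> shading_empty R n \<sigma> u v)"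

fun occurrence_in_mesh :: "mesh \<Rightarrow> mesh \<Rightarrow> (nat \<Rightarrow> nat) \<Rightarrow> bool" where
  "occurrence_in_mesh (k, \<tau>, R) (n, \<sigma>, Y) u \<longleftrightarrow>
     (\<exists>v. embeds k \<tau> n \<sigma> u v \<and> shading_empty R n \<sigma> u v \<and>
        (\<forall>(a, b)\<in>R. \<forall>x y. u a \<le> x \<and> x < u (a + 1) \<and> v b \<le> y \<and> y < v (b + 1) \<longrightarrow> (x, y) \<in> Y))"

definition avoids :: "nat \<Rightarrow> (nat \<Rightarrow> nat) \<Rightarrow> mesh \<Rightarrow> bool" where
  "avoids n \<sigma> p \<longleftrightarrow> \<not> (\<exists>u. occurrence_in_perm p n \<sigma> u)"

definition coincident :: "mesh \<Rightarrow> mesh \<Rightarrow> bool" where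
  "coincident p q \<longleftrightarrow> (\<forall>n \<sigma>. \<sigma> permutes {1..n} \<longrightarrow> (avoids n \<sigma> p \<longleftrightarrow> avoids n \<sigma> q))"

datatype direction = Upward | Downward | Leftward | Rightward

definition collapse :: "nat \<Rightarrow> nat \<Rightarrow> nat" where
  "collapse i a = (if a \<le> i then a else a - 1)"

definition insert_point :: "(nat \<Rightarrow> nat) \<Rightarrow> nat \<Rightarrow> nat \<Rightarrow> nat \<Rightarrow> nat" where
  "insert_point \<tau> i j x =
     (if x = i + 1 then j + 1
      else let y = \<tau> (collapse i x) in if y > j then y + 1 else y)"

fun shaded_beside :: "square \<Rightarrow> direction \<Rightarrow> square set" where
  "shaded_beside (i, j) Upward = {(i, j + 1), (i + 1, j + 1)}"
| "shaded_beside (i, j) Downward = {(i, j), (i + 1, j)}"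
| "shaded_beside (i, j) Leftward = {(i, j), (i, j + 1)}"
| "shaded_beside (i, j) Rightward = {(i + 1, j), (i + 1, j + 1)}"

text \<open>Only meaningful for an unshaded square \<open>(i, j)\<close> of the mesh.\<close>

fun add_point :: "mesh \<Rightarrow> square \<Rightarrow> direction \<Rightarrow> mesh" where
  "add_point (n, \<tau>, R) (i, j) d =
     (n + 1, insert_point \<tau> i j,
      {(a, b). a \<in> {0..n + 1} \<and> b \<in> {0..n + 1} \<and> (collapse i a, collapse j b) \<in> R}
        \<union> shaded_beside (i, j) d)"

definition star :: "mesh \<Rightarrow> square \<Rightarrow> mesh set" where
  "star p s = {add_point p s Upward, add_point p s Downward,
               add_point p s Leftward, add_point p s Rightward}"

text \<open>
  The positions of all points other than the one inserted at position \<open>i + 1\<close>; this also sends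
  \<open>0\<close> to \<open>0\<close> and \<open>n + 1\<close> to \<open>n + 2\<close>, as required by \<open>embeds\<close>.
\<close>

fun trivial_occurrence :: "square \<Rightarrow> nat \<Rightarrow> nat" where
  "trivial_occurrence (i, j) a = (if a \<le> i then a else a + 1)"

type_synonym force = "(nat \<times> direction) list"

fun force_on :: "force \<Rightarrow> mesh \<Rightarrow> bool" where
  "force_on F (n, \<tau>, R) \<longleftrightarrow>
     length F \<le> n \<and> distinct (map fst F) \<and> (\<forall>(t, d)\<in>set F. \<exists>i\<in>{1..n}. t = \<tau> i)"

text \<open>
  The entry of a force with first component \<open>t = \<tau>(i)\<close> refers to the letter \<open>c\<^sub>i = \<sigma>(u\<^sub>i)\<close>, where
  \<open>i = inv \<tau> t\<close>; the position of this letter in \<open>\<sigma>\<close> is \<open>u\<^sub>i\<close>.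
\<close>

fun strength_entry :: "(nat \<Rightarrow> nat) \<Rightarrow> (nat \<Rightarrow> nat) \<Rightarrow> (nat \<Rightarrow> nat) \<Rightarrow> nat \<times> direction \<Rightarrow> int" where
  "strength_entry \<tau> \<sigma> u (t, Upward) = int (\<sigma> (u (inv \<tau> t)))"
| "strength_entry \<tau> \<sigma> u (t, Downward) = - int (\<sigma> (u (inv \<tau> t)))"
| "strength_entry \<tau> \<sigma> u (t, Leftward) = - int (u (inv \<tau> t))"
| "strength_entry \<tau> \<sigma> u (t, Rightward) = int (u (inv \<tau> t))"

definition strength :: "mesh \<Rightarrow> force \<Rightarrow> (nat \<Rightarrow> nat) \<Rightarrow> (nat \<Rightarrow> nat) \<Rightarrow> int list" where
  "strength p F \<sigma> u = map (strength_entry (underlying p) \<sigma> u) F"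

definition stronger :: "mesh \<Rightarrow> force \<Rightarrow> (nat \<Rightarrow> nat) \<Rightarrow> (nat \<Rightarrow> nat) \<Rightarrow> (nat \<Rightarrow> nat) \<Rightarrow> bool" where
  "stronger p F \<sigma> u u' \<longleftrightarrow> (strength p F \<sigma> u', strength p F \<sigma> u) \<in> lex {(x, y). x < y}"

end

theory Submission imports Defs begin

text \<open>
  Write \<open>p = (\<tau>, R)\<close> and \<open>q = (\<tau>, R \<union> S)\<close>. Since \<open>q\<close> has more shading than \<open>p\<close>, every
  occurrence of \<open>q\<close> is one of \<open>p\<close>; the content is that a permutation \<open>\<sigma>\<close> containing \<open>p\<close> also
  contains \<open>q\<close>. The force serves as a potential function: the strengths of the occurrences in \<open>\<sigma>\<close> are
  bounded, so there is a strongest occurrence \<open>c\<close> of \<open>p\<close>, and this \<open>c\<close> is an occurrence of \<open>q\<close>.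

  Otherwise let \<open>s\<^sub>i\<close> be the first square of \<open>S\<close> in which \<open>c\<close> sees a point of \<open>\<sigma>\<close>, so that \<open>c\<close> is an
  occurrence of \<open>(\<tau>, R \<union> {s\<^sub>1, \<dots>, s\<^sub>i\<^sub>-\<^sub>1})\<close>. The hypothesis for \<open>i\<close> supplies a direction \<open>d\<close>. Adjoining to
  \<open>c\<close> the point of \<open>s\<^sub>i\<close> that lies furthest in direction \<open>d\<close> gives an occurrence \<open>w\<close> of the mesh
  pattern \<open>m\<close> obtained by adding a point to \<open>s\<^sub>i\<close> with direction \<open>d\<close>: the two squares that are newly shaded
  beside the added point are empty by extremality (\<open>add_point_occurrence\<close>). Now \<open>m\<close> contains an
  occurrence \<open>u\<close> of \<open>p\<close> that is stronger than the trivial one. Shaded squares of \<open>p\<close> are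
  mapped by \<open>u\<close> into the shading of \<open>m\<close>, so \<open>w \<circ> u\<close> is an occurrence of \<open>p\<close> in \<open>\<sigma>\<close>
  (\<open>occurrence_comp\<close>). Since \<open>w\<close> preserves the order of positions and of values, \<open>w \<circ> u\<close> is stronger
  than the image under \<open>w\<close> of the trivial occurrence (\<open>stronger_comp\<close>), which is \<open>c\<close>. This
  contradicts the choice of \<open>c\<close>. Formally the strongest occurrence is replaced by well-founded
  induction: each occurrence of \<open>p\<close> that is not one of \<open>q\<close> can be exchanged for a stronger one
  (\<open>stronger_occurrence\<close>), and this cannot go on forever (\<open>wf_lex_greater_bounded\<close>).
\<close>

section \<open>Embeddings of permutations\<close>

lemma strict_mono_on_less_iff:
  fixes f :: "nat \<Rightarrow> nat"
  assumes "strict_mono_on {0..m} f" "a \<le> m" "b \<le> m"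
  shows "f a < f b \<longleftrightarrow> a < b"
  using strict_mono_on_less[OF assms(1), of a b] assms(2,3) by simp

lemma strict_mono_on_image_unique:
  fixes f g :: "nat \<Rightarrow> nat"
  assumes "strict_mono_on {1..k} f" "strict_mono_on {1..k} g" "f ` {1..k} = g ` {1..k}"
    and "i \<in> {1..k}"
  shows "f i = g i"
proof -
  have sorted: "sorted (map h [1..<Suc k])" and distinct: "distinct (map h [1..<Suc k])"
    if "strict_mono_on {1..k} h" for h :: "nat \<Rightarrow> nat"
  proof -
    have "sorted_wrt (<) (map h [1..<Suc k])"
      using that by (auto simp: sorted_wrt_iff_nth_less strict_mono_on_def simp del: upt_Suc)
    then show "sorted (map h [1..<Suc k])" "distinct (map h [1..<Suc k])"
      by (auto simp: strict_sorted_iff simp del: upt_Suc)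
  qed
  have "map f [1..<Suc k] = map g [1..<Suc k]"
    by (rule sorted_distinct_set_unique)
       (use assms sorted distinct in \<open>auto simp: atLeastLessThanSuc_atLeastAtMost simp del: upt_Suc\<close>)
  with assms(4) show ?thesis by (auto simp del: upt_Suc)
qed

text \<open>
  A permutation \<open>\<tau>\<close> of \<open>{1..k}\<close> gives the rank of each of its letters, so an order isomorphic copy
  has its \<open>\<tau> i\<close>-th smallest letter at its \<open>i\<close>-th position. This single equation replaces the two
  last clauses of the definition of \<open>embeds\<close>.
\<close>

lemma embeds_iff:
  assumes "\<tau> permutes {1..k}"
  shows "embeds k \<tau> n \<sigma> u v \<longleftrightarrow>
    u 0 = 0 \<and> u (k + 1) = n + 1 \<and> strict_mono_on {0..k + 1} u \<and>
    v 0 = 0 \<and> v (k + 1) = n + 1 \<and> strict_mono_on {0..k + 1} v \<and>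
    (\<forall>i\<in>{1..k}. \<sigma> (u i) = v (\<tau> i))"
    (is "?L \<longleftrightarrow> ?R")
proof
  assume L: ?L
  have v: "strict_mono_on {1..k} v"
    using L by (auto simp: embeds_def strict_mono_on_def)
  have inv_in: "inv \<tau> i \<in> {1..k}" if "i \<in> {1..k}" for i
    using that permutes_in_image[OF permutes_inv[OF assms]] by blast
  have "strict_mono_on {1..k} (\<lambda>i. \<sigma> (u (inv \<tau> i)))"
  proof (rule strict_mono_onI)
    fix i j assume ij: "i \<in> {1..k}" "j \<in> {1..k}" "i < j"
    then have "\<tau> (inv \<tau> i) < \<tau> (inv \<tau> j)"
      using permutes_inverses(1)[OF assms] by simp
    then show "\<sigma> (u (inv \<tau> i)) < \<sigma> (u (inv \<tau> j))"
      using L ij inv_in unfolding embeds_def by blast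
  qed
  moreover have "(\<lambda>i. \<sigma> (u (inv \<tau> i))) ` {1..k} = v ` {1..k}"
  proof -
    have "(\<lambda>i. \<sigma> (u (inv \<tau> i))) ` {1..k} = (\<lambda>i. \<sigma> (u i)) ` inv \<tau> ` {1..k}"
      by (simp add: image_image)
    also have "\<dots> = v ` {1..k}"
      using L permutes_image[OF permutes_inv[OF assms]] by (simp add: embeds_def)
    finally show ?thesis .
  qed
  ultimately have eq: "\<sigma> (u (inv \<tau> i)) = v i" if "i \<in> {1..k}" for i
    using strict_mono_on_image_unique[OF _ v _ that] by blast
  have "\<sigma> (u i) = v (\<tau> i)" if "i \<in> {1..k}" for i
    using eq[of "\<tau> i"] that permutes_in_image[OF assms] permutes_inverses(2)[OF assms] by simp
  then show ?R using L by (simp add: embeds_def)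
next
  assume R: ?R
  have "v ` {1..k} = v ` \<tau> ` {1..k}"
    using permutes_image[OF assms] by simp
  also have "\<dots> = (\<lambda>i. \<sigma> (u i)) ` {1..k}"
    using R by (force simp: image_image)
  finally have img: "v ` {1..k} = (\<lambda>i. \<sigma> (u i)) ` {1..k}" .
  have "\<sigma> (u i) < \<sigma> (u j) \<longleftrightarrow> \<tau> i < \<tau> j" if "i \<in> {1..k}" "j \<in> {1..k}" for i j
  proof -
    have "\<tau> i \<le> k + 1" "\<tau> j \<le> k + 1"
      using that permutes_in_image[OF assms, of i] permutes_in_image[OF assms, of j] by auto
    then have "v (\<tau> i) < v (\<tau> j) \<longleftrightarrow> \<tau> i < \<tau> j"
      using R strict_mono_on_less_iff by blast
    then show ?thesis using R that by simp
  qed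
  then show ?L using R img by (simp add: embeds_def)
qed

lemma strict_mono_on_comp_into:
  assumes "strict_mono_on A f" "strict_mono_on B g" "f ` A \<subseteq> B"
  shows "strict_mono_on A (g \<circ> f)"
  using assms by (fastforce simp: strict_mono_on_def)

lemma strict_mono_on_range:
  fixes f :: "nat \<Rightarrow> nat"
  assumes "strict_mono_on {0..k + 1} f" "f 0 = 0" "f (k + 1) = m"
  shows "f ` {0..k + 1} \<subseteq> {0..m}"
proof -
  have "f x \<le> f (k + 1)" if "x \<in> {0..k + 1}" for x
    using that strict_mono_on_leD[OF assms(1), of x "k + 1"] by auto
  with assms(3) show ?thesis by auto
qed

lemma embeds_point:
  assumes "embeds k \<tau> n \<sigma> u v" "i \<in> {1..k}"
  shows "u i \<in> {1..n}"
proof -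
  have u: "strict_mono_on {0..k + 1} u" using assms(1) by (simp add: embeds_def)
  have "u 0 < u i" "u i < u (k + 1)"
    using assms(2) strict_mono_on_less_iff[OF u, of 0 i] strict_mono_on_less_iff[OF u, of i "k + 1"]
    by auto
  then show ?thesis using assms(1) by (auto simp: embeds_def)
qed

lemma embeds_comp:
  assumes \<tau>: "\<tau> permutes {1..k}" and \<rho>: "\<rho> permutes {1..m}"
    and uv: "embeds k \<tau> m \<rho> u v" and wz: "embeds m \<rho> n \<sigma> w z"
  shows "embeds k \<tau> n \<sigma> (w \<circ> u) (z \<circ> v)"
proof -
  note 1 = uv[unfolded embeds_iff[OF \<tau>]] and 2 = wz[unfolded embeds_iff[OF \<rho>]]
  have "strict_mono_on {0..k + 1} (w \<circ> u)" "strict_mono_on {0..k + 1} (z \<circ> v)"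
    using 1 2 strict_mono_on_range[of k u "m + 1"] strict_mono_on_range[of k v "m + 1"]
    by (auto intro!: strict_mono_on_comp_into)
  moreover have "\<sigma> (w (u i)) = z (v (\<tau> i))" if "i \<in> {1..k}" for i
    using that 1 2 embeds_point[OF uv that] by metis
  ultimately show ?thesis
    using 1 2 by (simp add: embeds_iff[OF \<tau>])
qed

section \<open>Composing occurrences\<close>

text \<open>
  Take \<open>c\<close> to be the last index before \<open>b\<close> at which \<open>w\<close> has not passed \<open>x\<close>. This locates the
  column or row of a mesh that contains a given point.
\<close>

lemma gap_exists:
  fixes w :: "nat \<Rightarrow> nat"
  assumes "w a \<le> x" "x < w b" "a \<le> b"
  shows "\<exists>c. a \<le> c \<and> c < b \<and> w c \<le> x \<and> x < w (c + 1)"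
  using assms(3,2,1)
proof (induction b rule: dec_induct)
  case base
  then show ?case by simp
next
  case (step b)
  show ?case
  proof (cases "x < w b")
    case True
    with step show ?thesis by (metis less_Suc_eq)
  next
    case False
    with step show ?thesis by (intro exI[of _ b]) auto
  qed
qed

text \<open>
  A point of \<open>\<sigma>\<close> in the image of a shaded square of \<open>p\<close> either belongs to the occurrence \<open>w\<close> of \<open>m\<close>,
  and then is a point of \<open>m\<close> inside a shaded square of \<open>p\<close>, or lies strictly inside a square of \<open>m\<close>,
  which is shaded because the shading of \<open>p\<close> is carried into that of \<open>m\<close>. Both are excluded.
\<close>

lemma occurrence_comp:
  assumes \<tau>: "\<tau> permutes {1..k}" and R: "R \<subseteq> {0..k} \<times> {0..k}"
    and \<rho>: "\<rho> permutes {1..m}" and \<sigma>: "\<sigma> permutes {1..n}"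
    and u: "occurrence_in_mesh (k, \<tau>, R) (m, \<rho>, Y) u"
    and w: "occurrence_in_perm (m, \<rho>, Y) n \<sigma> w"
  shows "occurrence_in_perm (k, \<tau>, R) n \<sigma> (w \<circ> u)"
proof -
  from u obtain v where uv: "embeds k \<tau> m \<rho> u v" and uR: "shading_empty R m \<rho> u v"
    and RY: "\<And>a b x y. (a, b) \<in> R \<Longrightarrow> u a \<le> x \<Longrightarrow> x < u (a + 1) \<Longrightarrow> v b \<le> y \<Longrightarrow> y < v (b + 1)
               \<Longrightarrow> (x, y) \<in> Y"
    by fastforce
  from w obtain z where wz: "embeds m \<rho> n \<sigma> w z" and wY: "shading_empty Y n \<sigma> w z"
    by auto
  note 1 = uv[unfolded embeds_iff[OF \<tau>]] and 2 = wz[unfolded embeds_iff[OF \<rho>]]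
  have False
    if ab: "(a, b) \<in> R" and x: "x \<in> {1..n}" "w (u a) < x" "x < w (u (a + 1))"
      "z (v b) < \<sigma> x" "\<sigma> x < z (v (b + 1))" for a b x
  proof -
    have le: "a \<le> k" "b \<le> k" using ab R by auto
    have um: "u a < u (a + 1)" and vm: "v b < v (b + 1)"
      using 1 le strict_mono_on_less_iff[of "k + 1" u a "a + 1"]
        strict_mono_on_less_iff[of "k + 1" v b "b + 1"] by auto
    have "u ` {0..k + 1} \<subseteq> {0..m + 1}" "v ` {0..k + 1} \<subseteq> {0..m + 1}"
      using 1 strict_mono_on_range by blast+
    then have ub: "u (a + 1) \<le> m + 1" and vb: "v (b + 1) \<le> m + 1"
      using le by (auto simp: image_subset_iff)
    obtain c where c: "u a \<le> c" "c < u (a + 1)" "w c \<le> x" "x < w (c + 1)"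
      using gap_exists[of w "u a" x "u (a + 1)"] x um by auto
    obtain e where e: "v b \<le> e" "e < v (b + 1)" "z e \<le> \<sigma> x" "\<sigma> x < z (e + 1)"
      using gap_exists[of z "v b" "\<sigma> x" "v (b + 1)"] x vm by auto
    have w_mono: "strict_mono_on {0..m + 1} w" and z_mono: "strict_mono_on {0..m + 1} z"
      using 2 by auto
    have not_point: False if i: "i \<in> {1..m}" "x = w i" for i
    proof -
      have \<rho>i: "\<rho> i \<in> {1..m}" "\<sigma> x = z (\<rho> i)"
        using i 2 permutes_in_image[OF \<rho>] by auto
      have "u a < i" "i < u (a + 1)"
        using x(2,3) i um ub strict_mono_on_less_iff[OF w_mono, of "u a" i]
          strict_mono_on_less_iff[OF w_mono, of i "u (a + 1)"] by auto
      moreover have "v b < \<rho> i" "\<rho> i < v (b + 1)"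
        using x(4,5) \<rho>i vm vb strict_mono_on_less_iff[OF z_mono, of "v b" "\<rho> i"]
          strict_mono_on_less_iff[OF z_mono, of "\<rho> i" "v (b + 1)"] by auto
      ultimately show False using uR ab i(1) unfolding shading_empty_def by blast
    qed
    have "w c \<noteq> x"
    proof
      assume "w c = x"
      moreover have "c \<noteq> 0" using 2 x(1) \<open>w c = x\<close> by (intro notI) auto
      ultimately show False using not_point[of c] c ub by auto
    qed
    moreover have "z e \<noteq> \<sigma> x"
    proof
      assume ze: "z e = \<sigma> x"
      have "\<sigma> x \<in> {1..n}" using x(1) permutes_in_image[OF \<sigma>] by blast
      then have "e \<noteq> 0" using 2 ze by (intro notI) auto
      then have "e \<in> {1..m}" using e vb by auto
      then have i: "inv \<rho> e \<in> {1..m}" "\<rho> (inv \<rho> e) = e"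
        using permutes_in_image[OF permutes_inv[OF \<rho>]] permutes_inverses(1)[OF \<rho>] by blast+
      then have "\<sigma> (w (inv \<rho> e)) = \<sigma> x" using 2 ze by simp
      then show False using not_point[OF i(1)] permutes_inj[OF \<sigma>] by (auto dest: injD)
    qed
    moreover have "(c, e) \<in> Y" using RY[OF ab c(1,2) e(1,2)] .
    ultimately show False
      using wY x(1) c(3,4) e(3,4) unfolding shading_empty_def by fastforce
  qed
  then have "shading_empty R n \<sigma> (w \<circ> u) (z \<circ> v)"
    unfolding shading_empty_def by auto
  with embeds_comp[OF \<tau> \<rho> uv wz] show ?thesis by auto
qed

section \<open>Adding a point to an occurrence\<close>

definition insert_at :: "nat \<Rightarrow> nat \<Rightarrow> (nat \<Rightarrow> nat) \<Rightarrow> nat \<Rightarrow> nat" where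
  "insert_at i c u x = (if x \<le> i then u x else if x = i + 1 then c else u (x - 1))"

lemma insert_at_trivial_occurrence: "insert_at i c u (trivial_occurrence (i, j) a) = u a"
  by (simp add: insert_at_def)

text \<open>
  The shift of the values above \<open>j\<close> in \<open>insert_point\<close> is undone by the shift of the indices in
  \<open>insert_at\<close>: the letters of the old occurrence keep their values.
\<close>

lemma insert_at_insert_point:
  "insert_at j y v (insert_point \<tau> i j x) = (if x = i + 1 then y else v (\<tau> (collapse i x)))"
  by (auto simp: insert_at_def insert_point_def Let_def)

lemma insert_at_strict_mono:
  assumes u: "strict_mono_on {0..n + 1} u" and c: "u i < c" "c < u (i + 1)" and i: "i \<le> n"
  shows "strict_mono_on {0..n + 2} (insert_at i c u)"
proof (rule strict_mono_onI)
  fix x y assume xy: "x \<in> {0..n + 2}" "y \<in> {0..n + 2}" "x < y"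
  have mono: "u a \<le> u b" if "a \<le> b" "b \<le> n + 1" for a b
    using that strict_mono_on_leD[OF u] by auto
  have smono: "u a < u b" if "a < b" "b \<le> n + 1" for a b
    using that strict_mono_onD[OF u] by auto
  consider "y \<le> i" | "y = i + 1" | "y > i + 1" "x \<le> i" | "y > i + 1" "x = i + 1"
    | "y > i + 1" "x > i + 1" by linarith
  then show "insert_at i c u x < insert_at i c u y"
  proof cases
    case 1
    then show ?thesis using xy i smono[of x y] by (simp add: insert_at_def)
  next
    case 2
    then show ?thesis using xy i c mono[of x i] by (simp add: insert_at_def)
  next
    case 3
    then show ?thesis using xy smono[of x "y - 1"] by (simp add: insert_at_def)
  next
    case 4
    then have "u (i + 1) \<le> u (y - 1)" using xy by (intro mono) auto
    then show ?thesis using 4 c by (simp add: insert_at_def)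
  next
    case 5
    then show ?thesis using xy smono[of "x - 1" "y - 1"] by (simp add: insert_at_def)
  qed
qed

text \<open>Inserting an entry only subdivides the gap \<open>i\<close> and renumbers the later ones.\<close>

lemma insert_at_gap:
  assumes "u i < c" "c < u (i + 1)"
    and "insert_at i c u a < x" "x < insert_at i c u (a + 1)"
  shows "u (collapse i a) < x" "x < u (collapse i a + 1)"
proof -
  consider "a < i" | "a = i" | "a = i + 1" | "a > i + 1" by linarith
  then have "u (collapse i a) < x \<and> x < u (collapse i a + 1)"
    using assms by cases (auto simp: insert_at_def collapse_def)
  then show "u (collapse i a) < x" "x < u (collapse i a + 1)" by auto
qed

lemma insert_point_permutes:
  assumes \<tau>: "\<tau> permutes {1..n}" and ij: "i \<le> n" "j \<le> n"
  shows "insert_point \<tau> i j permutes {1..n + 1}"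
proof (rule bij_imp_permutes)
  have in_range: "\<tau> x \<in> {1..n} \<longleftrightarrow> x \<in> {1..n}" for x
    using permutes_in_image[OF \<tau>] .
  have "inj_on (insert_point \<tau> i j) {1..n + 1}"
  proof (rule inj_onI)
    fix x y assume xy: "insert_point \<tau> i j x = insert_point \<tau> i j y"
    have "\<tau> (collapse i x) = \<tau> (collapse i y)" if "x \<noteq> i + 1" "y \<noteq> i + 1"
      using xy that by (auto simp: insert_point_def Let_def split: if_splits)
    then have "collapse i x = collapse i y" if "x \<noteq> i + 1" "y \<noteq> i + 1"
      using that permutes_inj[OF \<tau>] by (auto dest: injD)
    then show "x = y"
      using xy by (cases "x = i + 1"; cases "y = i + 1")
        (auto simp: insert_point_def Let_def collapse_def split: if_splits)
  qed
  moreover have "insert_point \<tau> i j ` {1..n + 1} \<subseteq> {1..n + 1}"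
  proof (rule image_subsetI)
    fix x assume x: "x \<in> {1..n + 1}"
    show "insert_point \<tau> i j x \<in> {1..n + 1}"
    proof (cases "x = i + 1")
      case True
      then show ?thesis using ij by (simp add: insert_point_def)
    next
      case False
      then have "collapse i x \<in> {1..n}" using x ij by (auto simp: collapse_def)
      then have "\<tau> (collapse i x) \<in> {1..n}" using in_range by blast
      then show ?thesis using False by (auto simp: insert_point_def Let_def)
    qed
  qed
  ultimately show "bij_betw (insert_point \<tau> i j) {1..n + 1} {1..n + 1}"
    by (simp add: bij_betw_def endo_inj_surj)
next
  fix x assume x: "x \<notin> {1..n + 1}"
  then have "collapse i x \<notin> {1..n}" using ij by (auto simp: collapse_def)
  then have "\<tau> (collapse i x) = collapse i x" using \<tau> by (simp add: permutes_def)
  then show "insert_point \<tau> i j x = x"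
    using x ij by (auto simp: insert_point_def Let_def collapse_def)
qed

lemma embeds_insert:
  assumes \<tau>: "\<tau> permutes {1..n}" and ij: "i \<le> n" "j \<le> n"
    and uv: "embeds n \<tau> N \<sigma> u v"
    and x: "u i < x" "x < u (i + 1)" "v j < \<sigma> x" "\<sigma> x < v (j + 1)"
  shows "embeds (n + 1) (insert_point \<tau> i j) N \<sigma> (insert_at i x u) (insert_at j (\<sigma> x) v)"
proof -
  note 1 = uv[unfolded embeds_iff[OF \<tau>]]
  have "\<sigma> (insert_at i x u a) = insert_at j (\<sigma> x) v (insert_point \<tau> i j a)"
    if a: "a \<in> {1..n + 1}" for a
  proof (cases "a = i + 1")
    case True
    then show ?thesis unfolding insert_at_insert_point by (simp add: insert_at_def)
  next
    case False
    then have "collapse i a \<in> {1..n}" "insert_at i x u a = u (collapse i a)"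
      using a ij by (auto simp: collapse_def insert_at_def)
    then show ?thesis using False 1 by (simp add: insert_at_insert_point)
  qed
  moreover have "strict_mono_on {0..n + 2} (insert_at i x u)"
    "strict_mono_on {0..n + 2} (insert_at j (\<sigma> x) v)"
    using insert_at_strict_mono 1 x ij by auto
  ultimately show ?thesis
    using 1 ij unfolding embeds_iff[OF insert_point_permutes[OF \<tau> ij]] by (simp add: insert_at_def)
qed

text \<open>
  How far the point of \<open>\<sigma>\<close> at position \<open>x\<close> lies in direction \<open>d\<close>. It decides both which point of a
  square can be added in direction \<open>d\<close> and the entries of strengths.
\<close>

fun reach :: "(nat \<Rightarrow> nat) \<Rightarrow> direction \<Rightarrow> nat \<Rightarrow> int" where
  "reach \<sigma> Upward x = int (\<sigma> x)"
| "reach \<sigma> Downward x = - int (\<sigma> x)"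
| "reach \<sigma> Leftward x = - int x"
| "reach \<sigma> Rightward x = int x"

text \<open>
  Both squares shaded beside the added point are parts of the original square \<open>(i, j)\<close>, and they are
  the ones lying beyond the added point in direction \<open>d\<close>.
\<close>

lemma shaded_beside_empty:
  assumes x: "u i < x" "x < u (i + 1)" "v j < \<sigma> x" "\<sigma> x < v (j + 1)"
    and furthest: "\<And>y. \<lbrakk>y \<in> {1..N}; u i < y; y < u (i + 1); v j < \<sigma> y; \<sigma> y < v (j + 1)\<rbrakk>
                     \<Longrightarrow> reach \<sigma> d y \<le> reach \<sigma> d x"
  shows "shading_empty (shaded_beside (i, j) d) N \<sigma> (insert_at i x u) (insert_at j (\<sigma> x) v)"
  unfolding shading_empty_def
proof (clarify)
  fix a b y
  assume ab: "(a, b) \<in> shaded_beside (i, j) d" and y: "y \<in> {1..N}"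
    and col: "insert_at i x u a < y" "y < insert_at i x u (a + 1)"
    and row: "insert_at j (\<sigma> x) v b < \<sigma> y" "\<sigma> y < insert_at j (\<sigma> x) v (b + 1)"
  have "collapse i a = i" "collapse j b = j"
    using ab by (cases d; auto simp: collapse_def)+
  then have "reach \<sigma> d y \<le> reach \<sigma> d x"
    using furthest[OF y] insert_at_gap[OF x(1,2) col] insert_at_gap[OF x(3,4) row] by simp
  then show False
    using ab col row by (cases d) (auto simp: insert_at_def)
qed

lemma add_point_occurrence:
  assumes \<tau>: "\<tau> permutes {1..n}" and ij: "i \<le> n" "j \<le> n"
    and uv: "embeds n \<tau> N \<sigma> u v" and R: "shading_empty R N \<sigma> u v"
    and x: "u i < x" "x < u (i + 1)" "v j < \<sigma> x" "\<sigma> x < v (j + 1)"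
    and furthest: "\<And>y. \<lbrakk>y \<in> {1..N}; u i < y; y < u (i + 1); v j < \<sigma> y; \<sigma> y < v (j + 1)\<rbrakk>
                     \<Longrightarrow> reach \<sigma> d y \<le> reach \<sigma> d x"
  shows "occurrence_in_perm (add_point (n, \<tau>, R) (i, j) d) N \<sigma> (insert_at i x u)"
proof -
  let ?T = "{(a, b). a \<in> {0..n + 1} \<and> b \<in> {0..n + 1} \<and> (collapse i a, collapse j b) \<in> R}"
  have "shading_empty ?T N \<sigma> (insert_at i x u) (insert_at j (\<sigma> x) v)"
    unfolding shading_empty_def
  proof (clarify)
    fix a b y
    assume ab: "(collapse i a, collapse j b) \<in> R" and y: "y \<in> {1..N}"
      and col: "insert_at i x u a < y" "y < insert_at i x u (a + 1)"
      and row: "insert_at j (\<sigma> x) v b < \<sigma> y" "\<sigma> y < insert_at j (\<sigma> x) v (b + 1)"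
    show False
      using R ab y insert_at_gap[OF x(1,2) col] insert_at_gap[OF x(3,4) row]
      unfolding shading_empty_def by blast
  qed
  then have "shading_empty (?T \<union> shaded_beside (i, j) d) N \<sigma> (insert_at i x u) (insert_at j (\<sigma> x) v)"
    using shaded_beside_empty[OF x furthest] unfolding shading_empty_def by blast
  then show ?thesis
    using embeds_insert[OF \<tau> ij uv x] by (simp del: atLeastAtMost_iff) blast
qed

section \<open>Strength\<close>

lemma strength_entry_reach: "strength_entry \<tau> \<sigma> u (t, d) = reach \<sigma> d (u (inv \<tau> t))"
  by (cases d) simp_all

lemma reach_embeds:
  assumes \<rho>: "\<rho> permutes {1..m}" and wz: "embeds m \<rho> n \<sigma> w z"
    and xy: "x \<in> {1..m}" "y \<in> {1..m}"
  shows "reach \<rho> d x < reach \<rho> d y \<Longrightarrow> reach \<sigma> d (w x) < reach \<sigma> d (w y)"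
    and "reach \<rho> d x = reach \<rho> d y \<Longrightarrow> reach \<sigma> d (w x) = reach \<sigma> d (w y)"
proof -
  note 1 = wz[unfolded embeds_iff[OF \<rho>]]
  have \<rho>xy: "\<rho> x \<in> {1..m}" "\<rho> y \<in> {1..m}" using xy permutes_in_image[OF \<rho>] by blast+
  have pos: "w a < w b" if "a < b" "a \<in> {1..m}" "b \<in> {1..m}" for a b
    using that 1 strict_mono_on_less_iff[of "m + 1" w a b] by auto
  have val: "z a < z b" if "a < b" "a \<in> {1..m}" "b \<in> {1..m}" for a b
    using that 1 strict_mono_on_less_iff[of "m + 1" z a b] by auto
  have \<sigma>w: "\<sigma> (w x) = z (\<rho> x)" "\<sigma> (w y) = z (\<rho> y)" using 1 xy by auto
  show "reach \<rho> d x < reach \<rho> d y \<Longrightarrow> reach \<sigma> d (w x) < reach \<sigma> d (w y)"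
    using xy \<rho>xy \<sigma>w by (cases d) (auto intro: pos val)
  show "reach \<rho> d x = reach \<rho> d y \<Longrightarrow> reach \<sigma> d (w x) = reach \<sigma> d (w y)"
    using \<sigma>w by (cases d) auto
qed

lemma lex_map_mono:
  assumes "(map f xs, map g xs) \<in> lex {(x, y). x < y}"
    and "\<And>x. x \<in> set xs \<Longrightarrow> f x < g x \<Longrightarrow> f' x < g' x"
    and "\<And>x. x \<in> set xs \<Longrightarrow> f x = g x \<Longrightarrow> f' x = g' x"
  shows "(map f' xs, map g' xs) \<in> lex {(x, y). x < y}"
  using assms by (induction xs) auto

text \<open>
  An embedding preserves the relative order of positions and of values, and strengths are compared
  by these orders alone.
\<close>

lemma stronger_comp:
  assumes \<tau>: "\<tau> permutes {1..k}" and F: "force_on F (k, \<tau>, R)"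
    and \<rho>: "\<rho> permutes {1..m}" and wz: "embeds m \<rho> n \<sigma> w z"
    and u: "u ` {1..k} \<subseteq> {1..m}" "u' ` {1..k} \<subseteq> {1..m}"
    and stronger: "stronger (k, \<tau>, R) F \<rho> u u'"
  shows "stronger (k, \<tau>, R) F \<sigma> (w \<circ> u) (w \<circ> u')"
  unfolding stronger_def strength_def
proof (rule lex_map_mono)
  show "(map (strength_entry (underlying (k, \<tau>, R)) \<rho> u') F,
         map (strength_entry (underlying (k, \<tau>, R)) \<rho> u) F) \<in> lex {(x, y). x < y}"
    using stronger by (simp add: stronger_def strength_def)
next
  fix e assume e: "e \<in> set F"
  obtain t d where td: "e = (t, d)" by force
  obtain i where "i \<in> {1..k}" "t = \<tau> i" using F e td by force
  then have "inv \<tau> t \<in> {1..k}" using permutes_inverses(2)[OF \<tau>] by simp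
  then have "u (inv \<tau> t) \<in> {1..m}" "u' (inv \<tau> t) \<in> {1..m}" using u by blast+
  note mono = reach_embeds[OF \<rho> wz this(2,1), of d]
  {
    assume "strength_entry (underlying (k, \<tau>, R)) \<rho> u' e < strength_entry (underlying (k, \<tau>, R)) \<rho> u e"
    then show "strength_entry (underlying (k, \<tau>, R)) \<sigma> (w \<circ> u') e
        < strength_entry (underlying (k, \<tau>, R)) \<sigma> (w \<circ> u) e"
      using mono(1) by (simp add: td strength_entry_reach)
  next
    assume "strength_entry (underlying (k, \<tau>, R)) \<rho> u' e = strength_entry (underlying (k, \<tau>, R)) \<rho> u e"
    then show "strength_entry (underlying (k, \<tau>, R)) \<sigma> (w \<circ> u') e
        = strength_entry (underlying (k, \<tau>, R)) \<sigma> (w \<circ> u) e"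
      using mono(2) by (simp add: td strength_entry_reach)
  }
qed

lemma stronger_cong:
  assumes "\<tau> permutes {1..k}" "force_on F (k, \<tau>, R)"
    and "\<And>i. i \<in> {1..k} \<Longrightarrow> u' i = u'' i"
  shows "stronger (k, \<tau>, R) F \<sigma> u u' \<longleftrightarrow> stronger (k, \<tau>, R) F \<sigma> u u''"
proof -
  have "strength_entry \<tau> \<sigma> u' e = strength_entry \<tau> \<sigma> u'' e" if e: "e \<in> set F" for e
  proof -
    obtain t d where td: "e = (t, d)" by force
    obtain i where i: "i \<in> {1..k}" "t = \<tau> i" using assms(2) e td by force
    then show ?thesis using assms(3) permutes_inverses(2)[OF assms(1)]
      by (simp add: td strength_entry_reach)
  qed
  then have "strength (k, \<tau>, R) F \<sigma> u' = strength (k, \<tau>, R) F \<sigma> u''"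
    by (simp add: strength_def)
  then show ?thesis by (simp add: stronger_def)
qed

lemma strength_le:
  assumes \<tau>: "\<tau> permutes {1..k}" and F: "force_on F (k, \<tau>, R)" and \<sigma>: "\<sigma> permutes {1..n}"
    and uv: "embeds k \<tau> n \<sigma> u v" and e: "e \<in> set (strength (k, \<tau>, R) F \<sigma> u)"
  shows "e \<le> int n"
proof -
  obtain t d where td: "(t, d) \<in> set F" "e = reach \<sigma> d (u (inv \<tau> t))"
    using e by (auto simp: strength_def strength_entry_reach)
  obtain i where "i \<in> {1..k}" "t = \<tau> i" using F td by force
  then have "u (inv \<tau> t) \<in> {1..n}"
    using permutes_inverses(2)[OF \<tau>] embeds_point[OF uv] by simp
  moreover from this have "\<sigma> (u (inv \<tau> t)) \<in> {1..n}" using permutes_in_image[OF \<sigma>] by blast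
  ultimately show ?thesis using td(2) by (cases d) auto
qed

lemma lex_greater_bounded:
  fixes B :: int
  assumes "(xs, ys) \<in> lex {(x, y). x < y}" "\<forall>y\<in>set ys. y \<le> B"
  shows "(ys, xs) \<in> lex {(x, y). y < x \<and> x \<le> B}"
  using assms
proof (induction xs arbitrary: ys)
  case Nil
  then show ?case by simp
next
  case (Cons x xs)
  then show ?case by (cases ys) auto
qed

text \<open>
  An integer entry that stays at most \<open>B\<close> can increase only finitely often, and the lexicographic
  order on lists of equal length inherits this.
\<close>

lemma wf_lex_greater_bounded: "wf (lex {(x, y). y < x \<and> x \<le> (B :: int)})"
proof (rule wf_lex)
  have "{(x, y). y < x \<and> x \<le> B} \<subseteq> measure (\<lambda>x. nat (B - x))" by auto
  then show "wf {(x, y). y < x \<and> x \<le> B}" using wf_measure wf_subset by blast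
qed

section \<open>Shading further squares\<close>

lemma occurrence_in_perm_mono:
  "occurrence_in_perm (k, \<tau>, R') n \<sigma> u \<Longrightarrow> R \<subseteq> R' \<Longrightarrow> occurrence_in_perm (k, \<tau>, R) n \<sigma> u"
  by (fastforce simp: shading_empty_def)

text \<open>
  The improvement step. The hypothesis on \<open>m\<close> speaks of one abstract added point, with no other point
  beyond it in direction \<open>d\<close> inside the square. Among the actual points of \<open>\<sigma>\<close> in that square, a
  furthest one plays this role, and the stronger occurrence found in \<open>m\<close> is transported to \<open>\<sigma>\<close>.
\<close>

lemma stronger_occurrence:
  assumes \<tau>: "\<tau> permutes {1..n}" and R: "R \<subseteq> {0..n} \<times> {0..n}" and F: "force_on F (n, \<tau>, R)"
    and \<sigma>: "\<sigma> permutes {1..N}"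
    and sq: "sq \<in> {0..n} \<times> {0..n}"
    and m: "m \<in> star (n, \<tau>, R') sq" "occurrence_in_mesh (n, \<tau>, R) m u"
      "stronger (n, \<tau>, R) F (underlying m) u (trivial_occurrence sq)"
    and cv: "embeds n \<tau> N \<sigma> c v" "shading_empty R' N \<sigma> c v"
    and hit: "\<not> shading_empty {sq} N \<sigma> c v"
  shows "\<exists>c'. occurrence_in_perm (n, \<tau>, R) N \<sigma> c' \<and> stronger (n, \<tau>, R) F \<sigma> c' c"
proof -
  obtain i j where sq_eq: "sq = (i, j)" by force
  with sq have ij: "i \<le> n" "j \<le> n" by auto
  obtain d where d: "m = add_point (n, \<tau>, R') (i, j) d"
    using m(1) unfolding sq_eq star_def by blast
  define B where
    "B = {x \<in> {1..N}. c i < x \<and> x < c (i + 1) \<and> v j < \<sigma> x \<and> \<sigma> x < v (j + 1)}"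
  have "finite B" "B \<noteq> {}"
    using hit by (auto simp: B_def sq_eq shading_empty_def)
  then have "Max (reach \<sigma> d ` B) \<in> reach \<sigma> d ` B" by simp
  then obtain x where "x \<in> B" "reach \<sigma> d x = Max (reach \<sigma> d ` B)" by auto
  then have x: "x \<in> B" and furthest: "\<And>y. y \<in> B \<Longrightarrow> reach \<sigma> d y \<le> reach \<sigma> d x"
    using \<open>finite B\<close> by auto
  define w where "w = insert_at i x c"
  define \<rho> where "\<rho> = insert_point \<tau> i j"
  obtain Y where Y: "m = (n + 1, \<rho>, Y)" using d by (simp add: \<rho>_def)
  have \<rho>: "\<rho> permutes {1..n + 1}"
    unfolding \<rho>_def by (rule insert_point_permutes[OF \<tau> ij])
  have "occurrence_in_perm m N \<sigma> w"
    unfolding d w_def by (rule add_point_occurrence[OF \<tau> ij cv])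
      (use x furthest in \<open>auto simp: B_def\<close>)
  then have w: "occurrence_in_perm (n + 1, \<rho>, Y) N \<sigma> w" by (simp add: Y)
  then obtain z where wz: "embeds (n + 1) \<rho> N \<sigma> w z" by auto
  from m(2) obtain v' where uv': "embeds n \<tau> (n + 1) \<rho> u v'" by (auto simp: Y)
  have "stronger (n, \<tau>, R) F \<sigma> (w \<circ> u) (w \<circ> trivial_occurrence (i, j))"
  proof (rule stronger_comp[OF \<tau> F \<rho> wz])
    show "u ` {1..n} \<subseteq> {1..n + 1}" using embeds_point[OF uv'] by blast
    show "stronger (n, \<tau>, R) F \<rho> u (trivial_occurrence (i, j))" using m(3) by (simp add: Y sq_eq)
  qed auto
  then have "stronger (n, \<tau>, R) F \<sigma> (w \<circ> u) c"
    by (subst (asm) stronger_cong[OF \<tau> F, where u'' = c])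
      (simp_all only: w_def comp_apply insert_at_trivial_occurrence)
  moreover have "occurrence_in_perm (n, \<tau>, R) N \<sigma> (w \<circ> u)"
    using occurrence_comp[OF \<tau> R \<rho> \<sigma> _ w] m(2) by (simp add: Y)
  ultimately show ?thesis by blast
qed

theorem lemma2p10:
  fixes n k :: nat and \<tau> :: "nat \<Rightarrow> nat" and R S :: "square set"
    and F :: force and s :: "nat \<Rightarrow> square"
  assumes "mesh_pattern (n, \<tau>, R)"
    and "force_on F (n, \<tau>, R)"
    and "S \<subseteq> {0..n} \<times> {0..n}"
    and "S = s ` {1..k}" and "inj_on s {1..k}"
    and "S \<inter> R = {}"
    and "\<And>i. i \<in> {1..k} \<Longrightarrow>
           \<exists>m \<in> star (n, \<tau>, R \<union> s ` {1..<i}) (s i). \<exists>u.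
             occurrence_in_mesh (n, \<tau>, R) m u \<and>
             stronger (n, \<tau>, R) F (underlying m) u (trivial_occurrence (s i))"
  shows "coincident (n, \<tau>, R) (n, \<tau>, R \<union> S)"
  unfolding coincident_def
proof (intro allI impI)
  fix N :: nat and \<sigma> :: "nat \<Rightarrow> nat"
  assume \<sigma>: "\<sigma> permutes {1..N}"
  have \<tau>: "\<tau> permutes {1..n}" and R: "R \<subseteq> {0..n} \<times> {0..n}" using assms(1) by auto
  have improve: "\<exists>c'. occurrence_in_perm (n, \<tau>, R) N \<sigma> c' \<and> stronger (n, \<tau>, R) F \<sigma> c' c"
    if c: "occurrence_in_perm (n, \<tau>, R) N \<sigma> c"
      and not_q: "\<not> occurrence_in_perm (n, \<tau>, R \<union> S) N \<sigma> c" for c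
  proof -
    from c obtain v where v: "embeds n \<tau> N \<sigma> c v" "shading_empty R N \<sigma> c v" by auto
    define hit where "hit i \<longleftrightarrow> i \<in> {1..k} \<and> \<not> shading_empty {s i} N \<sigma> c v" for i
    have "\<not> shading_empty (R \<union> S) N \<sigma> c v" using not_q v(1) by auto
    then have "\<exists>i. hit i"
      using v(2) by (fastforce simp: hit_def shading_empty_def assms(4))
    then obtain i where i: "hit i" and least: "\<And>i'. i' < i \<Longrightarrow> \<not> hit i'"
      using exists_least_iff[of hit] by blast
    have "shading_empty {s i'} N \<sigma> c v" if "i' \<in> {1..<i}" for i'
      using that i least by (auto simp: hit_def)
    then have earlier: "shading_empty (R \<union> s ` {1..<i}) N \<sigma> c v"
      using v(2) unfolding shading_empty_def by blast
    have ik: "i \<in> {1..k}" using i by (simp add: hit_def)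
    obtain m u where m: "m \<in> star (n, \<tau>, R \<union> s ` {1..<i}) (s i)"
      "occurrence_in_mesh (n, \<tau>, R) m u"
      "stronger (n, \<tau>, R) F (underlying m) u (trivial_occurrence (s i))"
      using assms(7)[OF ik] by blast
    have "s i \<in> {0..n} \<times> {0..n}" using ik assms(3,4) by blast
    then show ?thesis
      using stronger_occurrence[OF \<tau> R assms(2) \<sigma> _ m v(1) earlier] i by (simp add: hit_def)
  qed
  have "\<exists>c'. occurrence_in_perm (n, \<tau>, R \<union> S) N \<sigma> c'"
    if "occurrence_in_perm (n, \<tau>, R) N \<sigma> c" for c
    using that
  proof (induction "strength (n, \<tau>, R) F \<sigma> c" arbitrary: c
      rule: wf_induct_rule[OF wf_lex_greater_bounded[of "int N"]])
    case 1
    show ?case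
    proof (cases "occurrence_in_perm (n, \<tau>, R \<union> S) N \<sigma> c")
      case False
      then obtain c' where c': "occurrence_in_perm (n, \<tau>, R) N \<sigma> c'"
        and stronger: "stronger (n, \<tau>, R) F \<sigma> c' c"
        using improve 1(2) by blast
      have "\<forall>e\<in>set (strength (n, \<tau>, R) F \<sigma> c'). e \<le> int N"
        using c' strength_le[OF \<tau> assms(2) \<sigma>] by auto
      with stronger have "(strength (n, \<tau>, R) F \<sigma> c', strength (n, \<tau>, R) F \<sigma> c)
          \<in> lex {(x, y). y < x \<and> x \<le> int N}"
        by (auto simp: stronger_def intro: lex_greater_bounded)
      then show ?thesis using 1(1) c' by blast
    qed blast
  qed
  then show "avoids N \<sigma> (n, \<tau>, R) \<longleftrightarrow> avoids N \<sigma> (n, \<tau>, R \<union> S)"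
    unfolding avoids_def using occurrence_in_perm_mono by blast
qed

end
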